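(* Let $k\le n$ and let $\mathcal{B}$ be a (non-empty) collection of admissible subsets of $E_{\pm n}=[n]\cup[n]^*$, each of cardinality $k$. If $\mathcal{B}$ satisfies the Symmetric Exchange Axiom, then $\mathcal{B}$ satisfies the Maximality Property.
   Context: $[n]^*=\{1^*,\dots,n^*\}$ and $*$ is the involution $i\leftrightarrow i^*$; $S^*=\{s^*:s\in S\}$. A set $S\subseteq E_{\pm n}$ is admissible if $S\cap S^*=\emptyset$. A linear ordering $<$ on $E_{\pm n}$ is admissible if $i<j$ implies $j^*<i^*$. For admissible $k$-sets $A=\{a_1<\dots<a_k\}$, $B=\{b_1<\dots<b_k\}$ set $A\le B$ iff $a_i\le b_i$ for all $i$. Symmetric Exchange Axiom: for every $X,Y\in\mathcal{B}$ and every $i\in Y-X$, there exists $j\in X-Y$ such that $X\cup\{i\}-\{j\}\in\mathcal{B}$. Maximality Property: for every admissible ordering $<$ of $E_{\pm n}$, $\mathcal{B}$ contains a unique maximal element with respect to the induced order $\le$ on admissible $k$-sets (equivalently, $(E_{\pm n};\mathcal{B})$ is a symplectic matroid). *)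

theory Defs
  imports Main
begin

text \<open>The ground set \<open>[n] \<union> [n]\<^sup>*\<close>: \<open>Plain i\<close> stands for \<open>i\<close> and \<open>Starred i\<close> for \<open>i\<^sup>*\<close>.\<close>

datatype elt = Plain nat | Starred nat

fun star :: "elt \<Rightarrow> elt" where
  "star (Plain i) = Starred i"
| "star (Starred i) = Plain i"

definition ground :: "nat \<Rightarrow> elt set" where
  "ground n = Plain ` {1..n} \<union> Starred ` {1..n}"

definition admissible :: "nat \<Rightarrow> elt set \<Rightarrow> bool" where
  "admissible n S \<longleftrightarrow> S \<subseteq> ground n \<and> S \<inter> star ` S = {}"

text \<open>Orderings are strict: \<open>(i, j) \<in> r\<close> means \<open>i < j\<close>.\<close>

definition admissible_ordering :: "nat \<Rightarrow> elt rel \<Rightarrow> bool" where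
  "admissible_ordering n r \<longleftrightarrow>
     r \<subseteq> ground n \<times> ground n \<and> strict_linear_order_on (ground n) r \<and>
     (\<forall>i j. (i, j) \<in> r \<longrightarrow> (star j, star i) \<in> r)"

text \<open>\<open>as\<close> and \<open>bs\<close> are the increasing enumerations of \<open>A\<close> and \<open>B\<close>, which exist and are unique
  for finite sets on which \<open>r\<close> is a strict linear order; \<open>list_all2\<close> forces equal lengths.\<close>

definition set_le :: "elt rel \<Rightarrow> elt set \<Rightarrow> elt set \<Rightarrow> bool" where
  "set_le r A B \<longleftrightarrow>
     (\<exists>as bs. set as = A \<and> sorted_wrt (\<lambda>x y. (x, y) \<in> r) as \<and>
              set bs = B \<and> sorted_wrt (\<lambda>x y. (x, y) \<in> r) bs \<and>
              list_all2 (\<lambda>a b. a = b \<or> (a, b) \<in> r) as bs)"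

definition symmetric_exchange :: "elt set set \<Rightarrow> bool" where
  "symmetric_exchange \<B> \<longleftrightarrow>
     (\<forall>X\<in>\<B>. \<forall>Y\<in>\<B>. \<forall>i\<in>Y - X. \<exists>j\<in>X - Y. (X \<union> {i}) - {j} \<in> \<B>)"

definition maximal_in :: "elt rel \<Rightarrow> elt set set \<Rightarrow> elt set \<Rightarrow> bool" where
  "maximal_in r \<B> M \<longleftrightarrow> M \<in> \<B> \<and> (\<forall>X\<in>\<B>. set_le r M X \<longrightarrow> X = M)"

definition maximality_property :: "nat \<Rightarrow> elt set set \<Rightarrow> bool" where
  "maximality_property n \<B> \<longleftrightarrow>
     (\<forall>r. admissible_ordering n r \<longrightarrow> (\<exists>!M. maximal_in r \<B> M))"

end

theory Submission
  imports Defs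
begin

text \<open>Let \<open>X \<noteq> Y\<close> be maximal in \<open>\<B>\<close>, and let \<open>i\<close> be the largest element of their symmetric
  difference, say \<open>i \<in> Y - X\<close>. Exchanging \<open>i\<close> into \<open>X\<close> removes some \<open>j \<in> X - Y\<close>, and \<open>j < i\<close> by the
  choice of \<open>i\<close>; so the result is strictly above \<open>X\<close>, a contradiction. Existence holds because the
  sum of the ranks of the elements is strictly monotone in the order on \<open>k\<close>-sets.\<close>

text \<open>Translates \<open>r\<close> into natural numbers, so that \<open>Max\<close> and sums
  over sets become available.\<close>

definition rank :: "'a rel \<Rightarrow> 'a \<Rightarrow> nat" where
  "rank r x = card {y. (y, x) \<in> r}"

text \<open>By transitivity the elements below \<open>x\<close> are also below \<open>y\<close>;
  \<open>x\<close> itself is counted only for \<open>y\<close>.\<close>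

lemma rank_strict_mono:
  assumes "trans r" "irrefl r" "finite (Field r)" "(x, y) \<in> r"
  shows "rank r x < rank r y"
  unfolding rank_def
proof (rule psubset_card_mono)
  show "finite {z. (z, y) \<in> r}"
    using assms(3) by (rule finite_subset[rotated]) (auto simp: Field_def)
  show "{z. (z, x) \<in> r} \<subset> {z. (z, y) \<in> r}"
    using assms by (auto dest: transD irreflD)
qed

text \<open>Take \<open>m\<close> of largest rank: by totality, an \<open>x\<close> not below
  \<open>m\<close> would lie above it and have larger rank. This supplies the largest element of the
  symmetric difference.\<close>

lemma ex_max_rank:
  assumes "trans r" "irrefl r" "finite (Field r)" "total_on D r" "finite D" "D \<noteq> {}"
  obtains m where "m \<in> D" "\<And>x. x \<in> D \<Longrightarrow> x \<noteq> m \<Longrightarrow> (x, m) \<in> r"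
proof -
  have "Max (rank r ` D) \<in> rank r ` D"
    using assms by simp
  then obtain m where m: "m \<in> D" "rank r m = Max (rank r ` D)"
    by auto
  have "(x, m) \<in> r" if x: "x \<in> D" "x \<noteq> m" for x
  proof -
    have "\<not> rank r m < rank r x"
      using m x assms(5) by (simp add: leD)
    then show ?thesis
      using rank_strict_mono[OF assms(1-3)] assms(4) m(1) x unfolding total_on_def by blast
  qed
  with m(1) show thesis by (rule that)
qed

lemma ex_sorted_wrt_list:
  assumes "trans r" "total_on A r" "finite A"
  shows "\<exists>xs. set xs = A \<and> sorted_wrt (\<lambda>x y. (x, y) \<in> r) xs"
  using assms(3,2)
proof (induction A rule: finite_induct)
  case empty
  then show ?case by simp
next
  case (insert i A)
  then obtain xs where xs: "set xs = A" "sorted_wrt (\<lambda>x y. (x, y) \<in> r) xs"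
    unfolding total_on_def by blast
  \<comment> \<open>The filters split \<open>xs\<close> at the position of \<open>i\<close>;
    transitivity through \<open>i\<close> puts the first part below the second.\<close>
  let ?ys = "filter (\<lambda>x. (x, i) \<in> r) xs @ i # filter (\<lambda>x. (x, i) \<notin> r \<and> (i, x) \<in> r) xs"
  have "set ?ys = insert i A"
    using insert xs(1) unfolding total_on_def by auto
  moreover have "sorted_wrt (\<lambda>x y. (x, y) \<in> r) ?ys"
    using xs(2) assms(1) by (auto simp: sorted_wrt_append sorted_wrt_filter dest: transD)
  ultimately show ?case by blast
qed

lemma sorted_wrt_replace_head:
  assumes "trans r" "total_on (insert i (set xs)) r" "i \<notin> set xs" "(j, i) \<in> r"
    "sorted_wrt (\<lambda>x y. (x, y) \<in> r) (j # xs)"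
  shows "\<exists>ys. set ys = insert i (set xs) \<and> sorted_wrt (\<lambda>x y. (x, y) \<in> r) ys \<and>
    list_all2 (\<lambda>a b. a = b \<or> (a, b) \<in> r) (j # xs) ys"
  using assms(2-)
proof (induction xs arbitrary: j)
  case Nil
  then show ?case by (intro exI[of _ "[i]"]) auto
next
  case (Cons b xs)
  show ?case
  proof (cases "(i, b) \<in> r")
    \<comment> \<open>Here \<open>i\<close> takes the slot of \<open>j\<close> and the tail is
      matched with itself.\<close>
    case True
    with Cons.prems assms(1) show ?thesis
      by (intro exI[of _ "i # b # xs"]) (auto simp: list_all2_same dest: transD)
  next
    \<comment> \<open>Here \<open>b\<close> moves down into the slot of \<open>j\<close>, and
      \<open>b\<close> becomes the entry to be replaced by \<open>i\<close> in the shorter list;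
      hence the induction with \<open>j\<close> arbitrary.\<close>
    case False
    with Cons.prems have bi: "(b, i) \<in> r"
      unfolding total_on_def by auto
    have "\<exists>ys. set ys = insert i (set xs) \<and> sorted_wrt (\<lambda>x y. (x, y) \<in> r) ys \<and>
        list_all2 (\<lambda>a b. a = b \<or> (a, b) \<in> r) (b # xs) ys"
      using Cons.prems bi by (intro Cons.IH) (auto simp: total_on_def)
    then obtain ys where "set ys = insert i (set xs)" "sorted_wrt (\<lambda>x y. (x, y) \<in> r) ys"
        "list_all2 (\<lambda>a b. a = b \<or> (a, b) \<in> r) (b # xs) ys" by blast
    with Cons.prems bi show ?thesis
      by (intro exI[of _ "b # ys"]) auto
  qed
qed

text \<open>Entries before \<open>j\<close> stay in place, being below \<open>j\<close> and hence
  below \<open>i\<close>. From \<open>j\<close> on, \<open>sorted_wrt_replace_head\<close>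
  applies.\<close>

lemma sorted_wrt_replace:
  assumes "trans r" "irrefl r" "total_on (insert i (set xs)) r" "i \<notin> set xs" "(j, i) \<in> r"
    "j \<in> set xs" "sorted_wrt (\<lambda>x y. (x, y) \<in> r) xs"
  shows "\<exists>ys. set ys = insert i (set xs) - {j} \<and> sorted_wrt (\<lambda>x y. (x, y) \<in> r) ys \<and>
    list_all2 (\<lambda>a b. a = b \<or> (a, b) \<in> r) xs ys"
  using assms(3-)
proof (induction xs)
  case Nil
  then show ?case by simp
next
  case (Cons x xs)
  have tot: "total_on (insert i (set xs)) r"
    using Cons.prems by (auto simp: total_on_def)
  show ?case
  proof (cases "x = j")
    case True
    \<comment> \<open>Irreflexivity keeps \<open>j\<close> from recurring in the tail.\<close>
    have "insert i (set (x # xs)) - {j} = insert i (set xs)"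
      using True Cons.prems assms(2) by (auto dest: irreflD)
    then show ?thesis
      using sorted_wrt_replace_head[OF assms(1) tot, of j] True Cons.prems by simp
  next
    case False
    with Cons.prems Cons.IH[OF tot] obtain ys where ys:
        "set ys = insert i (set xs) - {j}" "sorted_wrt (\<lambda>x y. (x, y) \<in> r) ys"
        "list_all2 (\<lambda>a b. a = b \<or> (a, b) \<in> r) xs ys" by auto
    have "(x, j) \<in> r"
      using False Cons.prems by auto
    then have "(x, i) \<in> r"
      using assms(1) Cons.prems(3) by (auto dest: transD)
    with ys Cons.prems False show ?thesis
      by (intro exI[of _ "x # ys"]) auto
  qed
qed

lemma set_le_exchange:
  assumes "trans r" "irrefl r" "total_on (insert i X) r" "finite X" "i \<notin> X" "j \<in> X" "(j, i) \<in> r"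
  shows "set_le r X ((X \<union> {i}) - {j})"
proof -
  have "total_on X r"
    using assms(3) by (auto simp: total_on_def)
  then obtain xs where xs: "set xs = X" "sorted_wrt (\<lambda>x y. (x, y) \<in> r) xs"
    using ex_sorted_wrt_list assms(1,4) by blast
  then have "\<exists>ys. set ys = insert i (set xs) - {j} \<and> sorted_wrt (\<lambda>x y. (x, y) \<in> r) ys \<and>
      list_all2 (\<lambda>a b. a = b \<or> (a, b) \<in> r) xs ys"
    using assms by (intro sorted_wrt_replace) auto
  then show ?thesis
    using xs unfolding set_le_def by auto
qed

lemma sum_list_strict_mono:
  fixes f :: "'a \<Rightarrow> nat"
  assumes "list_all2 (\<lambda>a b. a = b \<or> (a, b) \<in> r) xs ys" "\<And>x y. (x, y) \<in> r \<Longrightarrow> f x < f y"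
  shows "xs = ys \<or> sum_list (map f xs) < sum_list (map f ys)"
  using assms(1)
proof (induction rule: list_all2_induct)
  case Nil
  then show ?case by simp
next
  case (Cons x xs y ys)
  then show ?case
    using assms(2)[of x y] by auto
qed

lemma set_le_sum_rank:
  assumes "trans r" "irrefl r" "finite (Field r)" "set_le r A B" "A \<noteq> B"
  shows "sum (rank r) A < sum (rank r) B"
proof -
  obtain xs ys where l: "set xs = A" "sorted_wrt (\<lambda>x y. (x, y) \<in> r) xs"
      "set ys = B" "sorted_wrt (\<lambda>x y. (x, y) \<in> r) ys"
      "list_all2 (\<lambda>a b. a = b \<or> (a, b) \<in> r) xs ys"
    using assms(4) unfolding set_le_def by blast
  \<comment> \<open>Without repetitions, summing over an enumeration is summing over its
    set.\<close>
  have distinct: "distinct zs" if "sorted_wrt (\<lambda>x y. (x, y) \<in> r) zs" for zs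
    using that assms(2) by (induction zs) (auto dest: irreflD)
  have "sum_list (map (rank r) xs) < sum_list (map (rank r) ys)"
    using sum_list_strict_mono[OF l(5), of "rank r"] rank_strict_mono[OF assms(1-3)] l(1,3) assms(5)
    by blast
  then show ?thesis
    using l distinct by (simp add: sum_list_distinct_conv_sum_set)
qed

text \<open>A member with the largest sum of ranks is maximal, since anything strictly above it
  would have a larger sum.\<close>

lemma ex_maximal_in:
  assumes "trans r" "irrefl r" "finite (Field r)" "finite \<B>" "\<B> \<noteq> {}"
  shows "\<exists>M. maximal_in r \<B> M"
proof -
  have "Max (sum (rank r) ` \<B>) \<in> sum (rank r) ` \<B>"
    using assms by simp
  then obtain M where M: "M \<in> \<B>" "sum (rank r) M = Max (sum (rank r) ` \<B>)"
    by auto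
  have "X = M" if "X \<in> \<B>" "set_le r M X" for X
  proof (rule ccontr)
    assume "X \<noteq> M"
    then have "sum (rank r) M < sum (rank r) X"
      using set_le_sum_rank[OF assms(1-3) that(2)] by simp
    then show False
      using M that assms(4) by (simp add: leD)
  qed
  then show ?thesis
    using M unfolding maximal_in_def by blast
qed

text \<open>The exchange argument for one orientation of the pair. Only \<open>X\<close> has to be
  maximal, and \<open>i\<close> only has to dominate \<open>X - Y\<close>, where the exchanged
  \<open>j\<close> lies.\<close>

lemma maximal_in_no_exchange:
  assumes "trans r" "irrefl r" "total_on (X \<union> Y) r" "finite X" "symmetric_exchange \<B>"
    "maximal_in r \<B> X" "Y \<in> \<B>" "i \<in> Y - X"
    "\<And>j. j \<in> X - Y \<Longrightarrow> (j, i) \<in> r"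
  shows False
proof -
  have "X \<in> \<B>"
    using assms(6) by (simp add: maximal_in_def)
  then obtain j where j: "j \<in> X - Y" "(X \<union> {i}) - {j} \<in> \<B>"
    using assms(5,7,8) unfolding symmetric_exchange_def by blast
  have "total_on (insert i X) r"
    using assms(3,8) by (auto simp: total_on_def)
  then have "set_le r X ((X \<union> {i}) - {j})"
    using assms j by (intro set_le_exchange) auto
  then have "(X \<union> {i}) - {j} = X"
    using j assms(6) by (simp add: maximal_in_def)
  then show False
    using j by auto
qed

lemma maximal_in_unique:
  assumes "trans r" "irrefl r" "finite (Field r)" "total_on E r" "finite E"
    "\<And>S. S \<in> \<B> \<Longrightarrow> S \<subseteq> E" "symmetric_exchange \<B>"
    "maximal_in r \<B> X" "maximal_in r \<B> Y"
  shows "X = Y"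
proof (rule ccontr)
  assume "X \<noteq> Y"
  let ?D = "(X - Y) \<union> (Y - X)"
  have B: "X \<in> \<B>" "Y \<in> \<B>"
    using assms(8,9) by (simp_all add: maximal_in_def)
  then have sub: "X \<subseteq> E" "Y \<subseteq> E"
    using assms(6) by auto
  then have fin: "finite X" "finite Y"
    using assms(5) finite_subset by auto
  have tot: "total_on (X \<union> Y) r" "total_on (Y \<union> X) r"
    using sub assms(4) by (auto intro: total_on_subset)
  then have "total_on ?D r"
    by (auto intro: total_on_subset)
  then obtain i where i: "i \<in> ?D" "\<And>x. x \<in> ?D \<Longrightarrow> x \<noteq> i \<Longrightarrow> (x, i) \<in> r"
    using ex_max_rank[OF assms(1-3)] fin \<open>X \<noteq> Y\<close>
    by (metis Diff_eq_empty_iff Un_empty finite_Diff finite_UnI subset_antisym)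
  \<comment> \<open>The side of the symmetric difference containing \<open>i\<close> decides which
    of the two maximal sets is exchanged.\<close>
  show False
  proof (cases "i \<in> Y - X")
    case True
    show False
      by (rule maximal_in_no_exchange[OF assms(1,2) tot(1) fin(1) assms(7,8) B(2) True])
        (use i True in blast)
  next
    case False
    with i(1) have "i \<in> X - Y" by blast
    then show False
      by (rule maximal_in_no_exchange[OF assms(1,2) tot(2) fin(2) assms(7,9) B(1)])
        (use i False in blast)
  qed
qed

theorem theorem3:
  fixes n k :: nat and \<B> :: "elt set set"
  assumes "k \<le> n"
    and "\<B> \<noteq> {}"
    and "\<And>S. S \<in> \<B> \<Longrightarrow> admissible n S \<and> card S = k"
    and "symmetric_exchange \<B>"
  shows "maximality_property n \<B>"
  unfolding maximality_property_def
proof (intro allI impI)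
  fix r assume "admissible_ordering n r"
  then have r: "r \<subseteq> ground n \<times> ground n" "trans r" "irrefl r" "total_on (ground n) r"
    unfolding admissible_ordering_def strict_linear_order_on_def by auto
  have fin: "finite (ground n)"
    by (simp add: ground_def)
  have sub: "S \<subseteq> ground n" if "S \<in> \<B>" for S
    using assms(3)[OF that] by (simp add: admissible_def)
  \<comment> \<open>All members are subsets of the finite ground set, so a largest sum of ranks is
    attained.\<close>
  then have "finite \<B>"
    using fin by (auto intro: finite_subset[of _ "Pow (ground n)"])
  moreover have "finite (Field r)"
    using r(1) fin by (auto simp: Field_def intro: finite_subset[of _ "ground n"])
  ultimately show "\<exists>!M. maximal_in r \<B> M"
    using ex_maximal_in[OF r(2,3) _ _ assms(2)]
      maximal_in_unique[OF r(2,3) _ r(4) fin sub assms(4)] by blast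
qed

end
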